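(* Let $L\ge 1$, $m\ge 2$ and $$K^m_{\ell_2}=\operatorname{cl}\Big\{(\mathbf{X}_1,\ldots,\mathbf{X}_m)\in\mathbb{S}^L_{++}\times(\mathbb{R}^{L\times L})^{m-1} : \mathbf{X}_1-\sum_{i=2}^m\mathbf{X}_i\mathbf{X}_1^{-1}\mathbf{X}_i^\top\succ 0\Big\}.$$ Then $\hat F(\mathbf{X}_1,\ldots,\mathbf{X}_m)=-\log\det\big(\mathbf{X}_1-\sum_{i=2}^m\mathbf{X}_i\mathbf{X}_1^{-1}\mathbf{X}_i^\top\big)-\log\det\mathbf{X}_1$, defined on the set where both matrices are positive definite, is a $2L$-self-concordant barrier for $K^m_{\ell_2}$.
   Context: $\mathbb{S}^L$, $\mathbb{S}^L_{++}$ denote the real symmetric and positive definite $L\times L$ matrices. A function $F$ on the interior of a closed convex set $K$ with nonempty interior is a $\nu$-self-concordant barrier if it is $C^3$ and convex, $F(\mathbf{x}_k)\to\infty$ whenever $\mathbf{x}_k$ converges to a boundary point of $K$, and for all interior $\mathbf{x}$ and directions $\mathbf{h}$: $|D^3F(\mathbf{x})[\mathbf{h},\mathbf{h},\mathbf{h}]|\le 2(D^2F(\mathbf{x})[\mathbf{h},\mathbf{h}])^{3/2}$ and $(DF(\mathbf{x})[\mathbf{h}])^2\le\nu\, D^2F(\mathbf{x})[\mathbf{h},\mathbf{h}]$. *)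

theory Defs
  imports "HOL-Analysis.Analysis"
begin

definition sym_pd :: "real^'n^'n \<Rightarrow> bool" where
  "sym_pd A \<longleftrightarrow> transpose A = A \<and> (\<forall>x. x \<noteq> 0 \<longrightarrow> 0 < x \<bullet> (A *v x))"

text \<open>A point (X_1,...,X_m) is a pair (X1, Y) with Y $ i the matrices X_2..X_m,
  indexed by the finite type 'k, so m - 1 = CARD('k) \<ge> 1.\<close>
definition schur_l2 :: "real^'n^'n \<Rightarrow> real^'n^'n^'k::finite \<Rightarrow> real^'n^'n" where
  "schur_l2 X1 Y = X1 - (\<Sum>i\<in>UNIV. Y $ i ** matrix_inv X1 ** transpose (Y $ i))"

definition l2_dom :: "((real^'n^'n) \<times> (real^'n^'n^'k::finite)) set" where
  "l2_dom = {(X1, Y). sym_pd X1 \<and> sym_pd (schur_l2 X1 Y)}"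

definition K_l2 :: "((real^'n^'n) \<times> (real^'n^'n^'k::finite)) set" where
  "K_l2 = closure {(X1, Y). sym_pd X1 \<and> sym_pd (schur_l2 X1 Y)}"

definition sym_space :: "((real^'n^'n) \<times> (real^'n^'n^'k::finite)) set" where
  "sym_space = {(X1, Y). transpose X1 = X1}"

definition F_hat :: "(real^'n^'n) \<times> (real^'n^'n^'k::finite) \<Rightarrow> real" where
  "F_hat p = - ln (det (schur_l2 (fst p) (snd p))) - ln (det (fst p))"

text \<open>nu-self-concordant barrier F with domain D for a closed convex set K inside
  the linear space E (interior taken relative to E). DF, D2F, D3F are the first three
  (Frechet, along E) derivatives; continuity of D3F gives C^3.\<close>
definition self_concordant_barrier ::
  "'a::real_normed_vector set \<Rightarrow> 'a set \<Rightarrow> 'a set \<Rightarrow> ('a \<Rightarrow> real) \<Rightarrow> real \<Rightarrow> bool" where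
  "self_concordant_barrier E K D F \<nu> \<longleftrightarrow>
     subspace E \<and> K \<subseteq> E \<and> closed K \<and> convex K \<and>
     D = (top_of_set E) interior_of K \<and> D \<noteq> {} \<and>
     convex_on D F \<and>
     (\<exists>DF D2F D3F.
        (\<forall>x\<in>D. (F has_derivative DF x) (at x within E) \<and>
           (\<forall>h\<in>E. ((\<lambda>y. DF y h) has_derivative D2F x h) (at x within E)) \<and>
           (\<forall>h\<in>E. \<forall>k\<in>E. ((\<lambda>y. D2F y h k) has_derivative D3F x h k) (at x within E))) \<and>
        (\<forall>h\<in>E. \<forall>k\<in>E. \<forall>l\<in>E. continuous_on D (\<lambda>x. D3F x h k l)) \<and>
        (\<forall>x\<in>D. \<forall>h\<in>E.
           \<bar>D3F x h h h\<bar> \<le> 2 * (D2F x h h) powr (3/2) \<and>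
           (DF x h)\<^sup>2 \<le> \<nu> * D2F x h h)) \<and>
     (\<forall>xs b. (\<forall>j. xs j \<in> D) \<longrightarrow> xs \<longlonglongrightarrow> b \<longrightarrow> b \<notin> D \<longrightarrow>
        filterlim (\<lambda>j. F (xs j)) at_top sequentially)"

end

theory Submission
  imports Defs
begin

text \<open>Write a point as \<open>(X, Y)\<close> and a direction as \<open>(H, K)\<close>, let \<open>S = X - \<Sum>\<^sub>i Y\<^sub>i X\<^sup>-\<^sup>1 Y\<^sub>i\<^sup>T\<close>
  and \<open>W\<^sub>i = K\<^sub>i - Y\<^sub>i X\<^sup>-\<^sup>1 H\<close>. Along a line \<open>S'' = - 2 \<Sum>\<^sub>i W\<^sub>i X\<^sup>-\<^sup>1 W\<^sub>i\<^sup>T\<close> and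
  \<open>S''' = 6 \<Sum>\<^sub>i W\<^sub>i X\<^sup>-\<^sup>1 H X\<^sup>-\<^sup>1 W\<^sub>i\<^sup>T\<close>. With \<open>a\<close>, \<open>b\<close>, \<open>w\<^sub>i\<close> the congruence-normalised \<open>S'\<close>, \<open>H\<close>, \<open>W\<^sub>i\<close>
  this gives \<open>F' = - tr a - tr b\<close>, \<open>F'' = |a|\<^sup>2 + 2 \<Sum>\<^sub>i |w\<^sub>i|\<^sup>2 + |b|\<^sup>2\<close> and
  \<open>F''' = - 2 tr a\<^sup>3 - 6 \<Sum>\<^sub>i tr (a w\<^sub>i w\<^sub>i\<^sup>T) - 6 \<Sum>\<^sub>i tr (w\<^sub>i b w\<^sub>i\<^sup>T) - 2 tr b\<^sup>3\<close> in Frobenius norms.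
  Submultiplicativity then reduces the third-order bound to \<open>tr M\<^sup>3 \<le> (tr M\<^sup>2) powr (3/2)\<close> for a
  symmetric 2x2 matrix \<open>M\<close>, and the parameter \<open>2L\<close> comes from Cauchy--Schwarz.\<close>

section \<open>Matrix calculus\<close>

text \<open>\<open>norm\<close> on matrices is the Frobenius norm, so Cauchy--Schwarz applied to
  each entry of the product, row against column, gives the bound. It serves both the calculus and
  the third-order estimate.\<close>

lemma norm_matrix_matrix_mult_le:
  fixes A :: "real^'n^'m" and B :: "real^'p^'n"
  shows "norm (A ** B) \<le> norm A * norm B"
proof (rule power2_le_imp_le)
  have "(norm (A ** B))\<^sup>2 = (\<Sum>i\<in>UNIV. \<Sum>j\<in>UNIV. (row i A \<bullet> column j B)\<^sup>2)"
    unfolding power2_norm_eq_inner inner_vec_def matrix_matrix_mult_def row_def column_def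
    by (simp add: power2_eq_square)
  also have "\<dots> \<le> (\<Sum>i\<in>UNIV. \<Sum>j\<in>UNIV. (row i A \<bullet> row i A) * (column j B \<bullet> column j B))"
    by (intro sum_mono Cauchy_Schwarz_ineq)
  also have "\<dots> = (\<Sum>i\<in>UNIV. row i A \<bullet> row i A) * (\<Sum>j\<in>UNIV. column j B \<bullet> column j B)"
    by (simp add: sum_product)
  also have "(\<Sum>i\<in>UNIV. row i A \<bullet> row i A) = (norm A)\<^sup>2"
    unfolding power2_norm_eq_inner inner_vec_def row_def by simp
  also have "(\<Sum>j\<in>UNIV. column j B \<bullet> column j B) = (norm B)\<^sup>2"
    unfolding power2_norm_eq_inner inner_vec_def column_def by (subst sum.swap) simp
  finally show "(norm (A ** B))\<^sup>2 \<le> (norm A * norm B)\<^sup>2"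
    by (simp add: power_mult_distrib)
qed simp

interpretation matmul:
  bounded_bilinear "(**) :: real^'n^'m \<Rightarrow> real^'p^'n \<Rightarrow> real^'p^'m"
proof
  show "\<exists>K. \<forall>(a::real^'n^'m) (b::real^'p^'n). norm (a ** b) \<le> norm a * norm b * K"
    by (rule exI[of _ 1]) (simp add: norm_matrix_matrix_mult_le)
qed (auto simp: vec_eq_iff matrix_matrix_mult_def sum.distrib sum_distrib_left algebra_simps)

lemma bounded_linear_transpose: "bounded_linear (transpose :: real^'n^'m \<Rightarrow> real^'m^'n)"
  by (intro linear_conv_bounded_linear[THEN iffD1] linearI) (auto simp: vec_eq_iff transpose_def)

lemma bounded_linear_trace: "bounded_linear (trace :: real^'n^'n \<Rightarrow> real)"
  by (intro linear_conv_bounded_linear[THEN iffD1] linearI)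
    (auto simp: trace_def sum.distrib sum_distrib_left)

lemma linear_trace: "linear (trace :: real^'n^'n \<Rightarrow> real)"
  by (rule bounded_linear.linear[OF bounded_linear_trace])

lemma linear_transpose: "linear (transpose :: real^'n^'m \<Rightarrow> real^'m^'n)"
  by (rule bounded_linear.linear[OF bounded_linear_transpose])

lemmas has_derivative_matrix_mult [derivative_intros] = matmul.FDERIV
lemmas has_derivative_transpose [derivative_intros] =
  bounded_linear.has_derivative[OF bounded_linear_transpose]
lemmas has_derivative_trace [derivative_intros] =
  bounded_linear.has_derivative[OF bounded_linear_trace]

lemma inner_matrix_eq_trace:
  fixes A B :: "real^'n^'m"
  shows "A \<bullet> B = trace (A ** transpose B)"
  by (simp add: inner_vec_def trace_def matrix_matrix_mult_def transpose_def)

lemma matrix_inv_right_left: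
  fixes A :: "real^'n^'n"
  assumes "invertible A"
  shows "A ** matrix_inv A = mat 1" "matrix_inv A ** A = mat 1"
  using someI_ex[OF assms[unfolded invertible_def]] by (auto simp: matrix_inv_def)

lemma matrix_inv_cancel:
  fixes A :: "real^'n^'n"
  assumes "invertible A"
  shows "A ** (matrix_inv A ** B) = B" "matrix_inv A ** (A ** B) = B"
  by (simp_all add: matrix_mul_assoc matrix_inv_right_left[OF assms])

lemma matrix_inv_unique:
  fixes A B :: "real^'n^'n"
  assumes "A ** B = mat 1"
  shows "matrix_inv A = B"
proof -
  have "invertible A"
    using assms matrix_left_right_inverse by (auto simp: invertible_def)
  then have "matrix_inv A ** (A ** B) = B"
    by (simp add: matrix_mul_assoc matrix_inv_right_left)
  then show ?thesis
    by (simp add: assms)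
qed

lemma transpose_matrix_inv:
  fixes A :: "real^'n^'n"
  assumes "invertible A"
  shows "transpose (matrix_inv A) = matrix_inv (transpose A)"
  by (metis assms matrix_inv_right_left(2) matrix_inv_unique matrix_transpose_mul transpose_mat)

section \<open>Derivative of the determinant and of its logarithm\<close>

lemma has_derivative_det_rows:
  fixes A :: "real^'n^'n"
  shows "(det has_derivative (\<lambda>H. \<Sum>k\<in>UNIV. det (\<chi> i. if i = k then H $ i else A $ i))) (at A)"
proof -
  have entry: "((\<lambda>A. A $ i $ j) has_derivative (\<lambda>H. H $ i $ j)) (at A)" for i j
    by (intro bounded_linear.has_derivative[OF bounded_linear_vec_nth] has_derivative_ident)
  have "((\<lambda>A. det A) has_derivative (\<lambda>H. \<Sum>p | p permutes (UNIV::'n set).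
      of_int (sign p) * (\<Sum>k\<in>UNIV. H $ k $ p k * (\<Prod>i\<in>UNIV - {k}. A $ i $ p i)))) (at A)"
    unfolding det_def
    by (intro has_derivative_sum has_derivative_mult_right has_derivative_prod entry)
  moreover have "(\<Sum>p | p permutes (UNIV::'n set).
      of_int (sign p) * (\<Sum>k\<in>UNIV. H $ k $ p k * (\<Prod>i\<in>UNIV - {k}. A $ i $ p i)))
     = (\<Sum>k\<in>UNIV. det (\<chi> i. if i = k then H $ i else A $ i))" for H :: "real^'n^'n"
  proof -
    \<comment> \<open>With row \<open>k\<close> taken from \<open>H\<close>, each Leibniz product
      contains exactly one factor of \<open>H\<close>: the term in which the product rule
      differentiates factor \<open>k\<close>.\<close>
    have "(\<Prod>i\<in>UNIV. (\<chi> i. if i = k then H $ i else A $ i) $ i $ p i)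
        = H $ k $ p k * (\<Prod>i\<in>UNIV - {k}. A $ i $ p i)" for p :: "'n \<Rightarrow> 'n" and k
      by (subst prod.remove[of _ k]) (auto intro!: prod.cong)
    then have "(\<Sum>k\<in>UNIV. det (\<chi> i. if i = k then H $ i else A $ i))
       = (\<Sum>k\<in>UNIV. \<Sum>p | p permutes (UNIV::'n set).
      of_int (sign p) * (H $ k $ p k * (\<Prod>i\<in>UNIV - {k}. A $ i $ p i)))"
      unfolding det_def by simp
    then show ?thesis
      by (subst (asm) sum.swap) (simp add: sum_distrib_left)
  qed
  ultimately show ?thesis
    by simp
qed

text \<open>Jacobi's formula; the row replacements are evaluated by Cramer's rule.\<close>
lemma has_derivative_det:
  fixes A :: "real^'n^'n"
  assumes "invertible A"
  shows "(det has_derivative (\<lambda>H. det A * trace (matrix_inv A ** H))) (at A)"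
proof -
  have "det (\<chi> i. if i = k then H $ i else A $ i) = (H ** matrix_inv A) $ k $ k * det A"
    for H :: "real^'n^'n" and k
  proof -
    \<comment> \<open>\<open>x\<close> holds the coordinates of row \<open>k\<close> of
      \<open>H\<close> in the rows of \<open>A\<close>, because
      \<open>H = (H ** matrix_inv A) ** A\<close>; Cramer's rule then returns coordinate
      \<open>k\<close> times \<open>det A\<close>.\<close>
    define x where "x = (H ** matrix_inv A) $ k"
    have "((H ** matrix_inv A) ** A) $ k = (\<Sum>i\<in>UNIV. x $ i *s row i A)"
      by (simp add: x_def vec_eq_iff matrix_matrix_mult_def[of _ A] row_def)
    then have "H $ k = (\<Sum>i\<in>UNIV. x $ i *s row i A)"
      by (simp add: matrix_mul_assoc[symmetric] matrix_inv_right_left[OF assms])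
    then show ?thesis
      using cramer_lemma_transpose[of k x A]
      by (simp add: x_def row_def cong: if_cong)
  qed
  then have "(\<Sum>k\<in>UNIV. det (\<chi> i. if i = k then H $ i else A $ i)) = det A * trace (matrix_inv A ** H)"
    for H :: "real^'n^'n"
    by (simp add: trace_mul_sym[of "matrix_inv A"]) (simp add: trace_def sum_distrib_left mult.commute)
  then show ?thesis
    using has_derivative_det_rows[of A] by simp
qed

lemma has_derivative_ln_det [derivative_intros]:
  fixes f :: "'a::real_normed_vector \<Rightarrow> real^'n^'n"
  assumes "(f has_derivative f') (at x within T)" and "0 < det (f x)"
  shows "((\<lambda>y. ln (det (f y))) has_derivative (\<lambda>h. trace (matrix_inv (f x) ** f' h))) (at x within T)"
proof -
  have "invertible (f x)"
    using assms(2) invertible_det_nz by fastforce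
  then have "((\<lambda>y. det (f y)) has_derivative (\<lambda>h. det (f x) * trace (matrix_inv (f x) ** f' h))) (at x within T)"
    using has_derivative_compose[OF assms(1) has_derivative_det] by simp
  from has_derivative_ln[OF assms(2) this] show ?thesis
    by (rule has_derivative_eq_rhs) (use assms(2) in \<open>simp add: fun_eq_iff\<close>)
qed

section \<open>Continuity and derivative of the matrix inverse\<close>

lemma continuous_on_det: "continuous_on S (det :: real^'n^'n \<Rightarrow> real)"
  using has_derivative_continuous[OF has_derivative_det_rows] continuous_at_imp_continuous_on by blast

text \<open>Column \<open>j\<close> of the inverse solves a linear system with right-hand side
  \<open>axis j 1\<close>. The purpose is continuity of the inverse: its entries become quotients of
  determinants.\<close>

lemma matrix_inv_cramer:
  fixes A :: "real^'n^'n"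
  assumes "invertible A"
  shows "matrix_inv A = (\<chi> k j. det (\<chi> i l. if l = k then axis j 1 $ i else A $ i $ l) / det A)"
proof -
  have "column j (matrix_inv A) $ k = det (\<chi> i l. if l = k then axis j 1 $ i else A $ i $ l) / det A" for j k
  proof -
    have "A *v column j (matrix_inv A) = axis j 1"
      using matrix_inv_right_left(1)[OF assms]
      by (metis matrix_vector_mul_assoc matrix_vector_mul_lid matrix_vector_mult_basis)
    then show ?thesis
      using cramer[of A "column j (matrix_inv A)" "axis j 1"] assms
      by (simp add: invertible_det_nz vec_eq_iff)
  qed
  then show ?thesis
    by (simp add: vec_eq_iff column_def)
qed

lemma continuous_matrix_inv:
  fixes A :: "real^'n^'n"
  assumes "invertible A"
  shows "isCont matrix_inv A"
proof -
  have "continuous_on {B. det B \<noteq> 0} (\<lambda>A::real^'n^'n. if l = k then axis j 1 $ i else A $ i $ l)"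
    for i j k l :: 'n
    by (cases "l = k") (auto intro!: continuous_intros)
  then have "continuous_on {B. det B \<noteq> 0} (\<lambda>A::real^'n^'n. (\<chi> k j. det (\<chi> i l. if l = k then axis j 1 $ i else A $ i $ l) / det A))"
    by (intro continuous_intros continuous_on_det continuous_on_compose2[OF continuous_on_det[of UNIV]])
      auto
  then have "continuous_on {B. det B \<noteq> 0} (matrix_inv :: real^'n^'n \<Rightarrow> _)"
    by (rule continuous_on_eq) (simp add: matrix_inv_cramer invertible_det_nz)
  moreover have "open {B::real^'n^'n. det B \<noteq> 0}"
    by (intro open_Collect_neq continuous_on_det continuous_on_const)
  ultimately show ?thesis
    using assms by (simp add: continuous_on_eq_continuous_at invertible_det_nz)
qed

text \<open>The remainder \<open>B^-1 - A^-1 + A^-1 (B - A) A^-1\<close> equals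
  \<open>(A^-1 - B^-1) (B - A) A^-1\<close>, which is of lower order than \<open>B - A\<close> by
  continuity of the inverse.\<close>

lemma has_derivative_matrix_inv_at:
  fixes A :: "real^'n^'n"
  assumes "invertible A"
  shows "(matrix_inv has_derivative (\<lambda>H. - (matrix_inv A ** H ** matrix_inv A))) (at A)"
proof -
  have "open {B::real^'n^'n. det B \<noteq> 0}"
    by (intro open_Collect_neq continuous_on_det continuous_on_const)
  then obtain e where e: "0 < e" "\<And>B. dist B A < e \<Longrightarrow> invertible B"
    using assms by (auto simp: open_dist invertible_det_nz)
  show ?thesis
  proof (rule has_derivativeI_sandwich[OF e(1)])
    show "bounded_linear (\<lambda>H. - (matrix_inv A ** H ** matrix_inv A))"
      by (intro bounded_linear_minus bounded_linear_compose[OF matmul.bounded_linear_left]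
          matmul.bounded_linear_right)
    show "((\<lambda>B. norm (matrix_inv A - matrix_inv B) * norm (matrix_inv A)) \<longlongrightarrow> 0) (at A)"
      using continuous_matrix_inv[OF assms]
      by (auto intro!: tendsto_eq_intros simp: isCont_def)
  next
    fix B assume B: "B \<noteq> A" "dist B A < e"
    have "matrix_inv B ** (B - A) ** matrix_inv A = matrix_inv A - matrix_inv B"
      using e(2)[OF B(2)] assms unfolding matmul.diff_left matmul.diff_right
      by (simp add: matrix_inv_right_left matrix_mul_assoc[symmetric])
    then have "matrix_inv B - matrix_inv A + matrix_inv A ** (B - A) ** matrix_inv A
        = (matrix_inv A - matrix_inv B) ** (B - A) ** matrix_inv A"
      by (simp only: matmul.diff_left[of "matrix_inv A"] matmul.diff_left[of "matrix_inv A ** _"]) simp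
    also have "norm \<dots> \<le> norm (matrix_inv A - matrix_inv B) * norm (B - A) * norm (matrix_inv A)"
      by (meson mult_right_mono norm_ge_zero norm_matrix_matrix_mult_le order_trans)
    finally show "norm (matrix_inv B - matrix_inv A - - (matrix_inv A ** (B - A) ** matrix_inv A)) / norm (B - A)
       \<le> norm (matrix_inv A - matrix_inv B) * norm (matrix_inv A)"
      using B by (simp add: divide_simps mult_ac)
  qed
qed

lemma has_derivative_matrix_inv [derivative_intros]:
  fixes f :: "'a::real_normed_vector \<Rightarrow> real^'n^'n"
  assumes "(f has_derivative f') (at x within T)" and "invertible (f x)"
  shows "((\<lambda>y. matrix_inv (f y)) has_derivative (\<lambda>h. - (matrix_inv (f x) ** f' h ** matrix_inv (f x)))) (at x within T)"
  using has_derivative_compose[OF assms(1) has_derivative_matrix_inv_at[OF assms(2)]] .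

section \<open>Positive definite matrices\<close>

lemma norm_matrix_vector_mult_le:
  fixes A :: "real^'n^'m"
  shows "norm (A *v x) \<le> norm A * norm x"
proof (rule power2_le_imp_le)
  have "(norm (A *v x))\<^sup>2 = (\<Sum>i\<in>UNIV. (A $ i \<bullet> x)\<^sup>2)"
    unfolding power2_norm_eq_inner inner_vec_def[of "A *v x"]
    by (simp add: matrix_vector_mul_component power2_eq_square)
  also have "\<dots> \<le> (\<Sum>i\<in>UNIV. (A $ i \<bullet> A $ i) * (x \<bullet> x))"
    by (intro sum_mono Cauchy_Schwarz_ineq)
  also have "\<dots> = (norm A * norm x)\<^sup>2"
    unfolding power_mult_distrib power2_norm_eq_inner inner_vec_def[of A]
    by (simp add: sum_distrib_right)
  finally show "(norm (A *v x))\<^sup>2 \<le> (norm A * norm x)\<^sup>2" .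
qed simp

lemma posdef_imp_invertible:
  fixes A :: "real^'n^'n"
  assumes "\<And>x. x \<noteq> 0 \<Longrightarrow> 0 < x \<bullet> (A *v x)"
  shows "invertible A"
  unfolding invertible_left_inverse matrix_left_invertible_ker
  using assms by fastforce

lemma sym_pd_imp_invertible: "sym_pd A \<Longrightarrow> invertible A"
  by (auto simp: sym_pd_def intro: posdef_imp_invertible)

lemma inner_matrix_vector_sym:
  fixes A :: "real^'n^'n"
  assumes "transpose A = A"
  shows "x \<bullet> (A *v y) = y \<bullet> (A *v x)"
  by (metis assms dot_lmul_matrix inner_commute transpose_matrix_vector)

text \<open>Gram--Schmidt for the inner product induced by \<^term>\<open>A\<close>.\<close>
lemma sym_pd_orthonormal_family:
  fixes A :: "real^'n^'n" and I :: "'n set"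
  assumes "sym_pd A"
  shows "\<exists>v :: 'n \<Rightarrow> real^'n. \<forall>i\<in>I. \<forall>j\<in>I. v i \<bullet> (A *v v j) = (if i = j then 1 else 0)"
proof (induction I rule: finite_induct[OF finite])
  case 1
  show ?case by simp
next
  case (2 k I)
  then obtain v :: "'n \<Rightarrow> real^'n"
    where v: "\<And>i j. i \<in> I \<Longrightarrow> j \<in> I \<Longrightarrow> v i \<bullet> (A *v v j) = (if i = j then 1 else 0)"
    by blast
  \<comment> \<open>Since \<open>k\<close> is not in \<open>I\<close>, there are fewer vectors
    \<open>A *v v i\<close> than the dimension, so some nonzero \<open>x\<close> is orthogonal to
    all of them; this is \<open>A\<close>-orthogonality to every \<open>v i\<close>.\<close>
  have "dim ((\<lambda>i. A *v v i) ` I) \<le> card I"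
    by (meson card_image_le dim_le_card' finite finite_imageI order_trans)
  also have "card I < DIM(real^'n)"
    using psubset_card_mono[of UNIV I] 2(2) by auto
  finally obtain x where x: "x \<noteq> 0" "\<And>i. i \<in> I \<Longrightarrow> x \<bullet> (A *v v i) = 0"
    using orthogonal_to_subspace_exists[of "(\<lambda>i. A *v v i) ` I"]
    by (metis image_eqI orthogonal_def span_base)
  define y where "y = (1 / sqrt (x \<bullet> (A *v x))) *\<^sub>R x"
  have pos: "0 < x \<bullet> (A *v x)"
    using assms x by (simp add: sym_pd_def)
  have sym: "transpose A = A"
    using assms by (simp add: sym_pd_def)
  have yv: "y \<bullet> (A *v v i) = 0" "v i \<bullet> (A *v y) = 0" if "i \<in> I" for i
    using x(2)[OF that] inner_matrix_vector_sym[OF sym, of "v i" y] by (simp_all add: y_def)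
  have yy: "y \<bullet> (A *v y) = 1"
    using pos by (simp add: y_def matrix_vector_mult_scaleR)
  show ?case
    using v yv yy 2(2) by (intro exI[of _ "v(k := y)"]) auto
qed

text \<open>The columns of \<open>T\<close> are an \<open>A\<close>-orthonormal basis, so
  \<open>transpose T ** A ** T\<close> is their Gram matrix. In the later congruences
  \<open>T\<close> plays the role of an inverse square root of \<open>A\<close>.\<close>

lemma sym_pd_factorization:
  fixes A :: "real^'n^'n"
  assumes "sym_pd A"
  obtains T :: "real^'n^'n" where "invertible T" "transpose T ** A ** T = mat 1" "matrix_inv A = T ** transpose T"
proof -
  obtain v :: "'n \<Rightarrow> real^'n" where v: "\<And>i j. v i \<bullet> (A *v v j) = (if i = j then 1 else 0)"
    using sym_pd_orthonormal_family[OF assms, of UNIV] by blast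
  define T where "T = (\<chi> i j. v j $ i)"
  have "(transpose T ** (A ** T)) $ i $ j = v i \<bullet> (A *v v j)" for i j
    by (simp add: T_def matrix_matrix_mult_def matrix_vector_mult_def transpose_def inner_vec_def)
  then have 1: "transpose T ** A ** T = mat 1"
    by (simp add: v vec_eq_iff mat_def matrix_mul_assoc)
  then have inv: "invertible T"
    unfolding invertible_left_inverse by blast
  have "transpose T ** A = matrix_inv T"
    using 1 inv by (metis matrix_inv_unique matrix_left_right_inverse)
  then have "T ** transpose T ** A = mat 1"
    by (simp add: matrix_mul_assoc[symmetric] matrix_inv_right_left[OF inv])
  then have "matrix_inv A = T ** transpose T"
    by (metis matrix_inv_unique matrix_left_right_inverse)
  with 1 inv that show ?thesis by blast
qed

lemma sym_pd_det_pos: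
  fixes A :: "real^'n^'n"
  assumes "sym_pd A"
  shows "0 < det A"
proof -
  obtain T :: "real^'n^'n" where T: "invertible T" "transpose T ** A ** T = mat 1"
    by (rule sym_pd_factorization[OF assms])
  from arg_cong[OF T(2), of det] have "(det T)\<^sup>2 * det A = 1"
    by (simp add: det_mul det_transpose power2_eq_square mult_ac)
  then show ?thesis
    by (metis zero_less_mult_pos zero_less_one zero_le_power2 order_le_less mult_zero_left zero_neq_one)
qed

text \<open>At a zero \<open>x\<close> of the form with \<open>A *v x \<noteq> 0\<close>, a small
  step against \<open>A *v x\<close> would make the form negative. For boundary limits this means: a
  limit of positive definite matrices that is not positive definite is singular.\<close>

lemma psd_singular_or_sym_pd:
  fixes A :: "real^'n^'n"
  assumes sym: "transpose A = A" and psd: "\<And>x. 0 \<le> x \<bullet> (A *v x)" and "det A \<noteq> 0"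
  shows "sym_pd A"
  unfolding sym_pd_def
proof (intro conjI allI impI sym)
  fix x :: "real^'n"
  assume "x \<noteq> 0"
  have "A *v x \<noteq> 0"
    using \<open>x \<noteq> 0\<close> assms(3) invertible_det_nz invertible_left_inverse matrix_left_invertible_ker by blast
  show "0 < x \<bullet> (A *v x)"
  proof (rule ccontr)
    assume "\<not> 0 < x \<bullet> (A *v x)"
    then have x0: "x \<bullet> (A *v x) = 0"
      using psd[of x] by simp
    define y where "y = A *v x"
    define c where "c = y \<bullet> (A *v y)"
    \<comment> \<open>Any positive \<open>t\<close> with \<open>c * t < 2 * (y \<bullet> y)\<close>
      makes the form negative at \<open>x - t *\<^sub>R y\<close>; the \<open>+ 1\<close> covers
      \<open>c = 0\<close>.\<close>
    define t where "t = (y \<bullet> y) / (c + 1)"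
    have c: "0 \<le> c" and y: "0 < y \<bullet> y"
      using psd \<open>A *v x \<noteq> 0\<close> by (auto simp: c_def y_def)
    have "x \<bullet> (A *v y) = y \<bullet> y"
      using inner_matrix_vector_sym[OF sym, of x y] by (simp add: y_def)
    then have "(x - t *\<^sub>R y) \<bullet> (A *v (x - t *\<^sub>R y)) = t * (c * t - 2 * (y \<bullet> y))"
      using x0 by (simp add: y_def[symmetric] c_def matrix_vector_mult_diff_distrib
          matrix_vector_mult_scaleR inner_diff_left inner_diff_right algebra_simps)
    moreover have "c * t < 2 * (y \<bullet> y)" "0 < t"
      using c y by (auto simp: t_def field_simps intro!: add_nonneg_pos mult_pos_pos)
    ultimately have "(x - t *\<^sub>R y) \<bullet> (A *v (x - t *\<^sub>R y)) < 0"
      by (simp add: mult_pos_neg)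
    then show False
      using psd[of "x - t *\<^sub>R y"] by simp
  qed
qed

text \<open>By compactness the form has a positive minimum \<open>c\<close> on the unit sphere, and
  changing \<open>A\<close> by less than \<open>c\<close> in norm changes the form there by less
  than \<open>c\<close>.\<close>

lemma open_posdef: "open {A::real^'n^'n. \<forall>x. x \<noteq> 0 \<longrightarrow> 0 < x \<bullet> (A *v x)}"
  unfolding open_dist
proof safe
  fix A :: "real^'n^'n"
  assume A: "\<forall>x. x \<noteq> 0 \<longrightarrow> 0 < x \<bullet> (A *v x)"
  have "compact (sphere 0 1 :: (real^'n) set)" "sphere 0 1 \<noteq> ({} :: (real^'n) set)"
    by (auto intro: exI[of _ "axis _ 1"])
  moreover have "continuous_on (sphere 0 1) (\<lambda>x. x \<bullet> (A *v x))"
    by (intro continuous_intros linear_continuous_on) simp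
  ultimately obtain x0 where x0: "x0 \<in> sphere 0 1"
    "\<And>y. y \<in> sphere 0 1 \<Longrightarrow> x0 \<bullet> (A *v x0) \<le> y \<bullet> (A *v y)"
    using continuous_attains_inf[of "sphere 0 1" "\<lambda>x. x \<bullet> (A *v x)"] by blast
  define c where "c = x0 \<bullet> (A *v x0)"
  have "x0 \<noteq> 0"
    using x0(1) by auto
  then have "0 < c"
    using A by (simp add: c_def)
  moreover have "0 < x \<bullet> (B *v x)" if "dist B A < c" "x \<noteq> 0" for B x
  proof -
    define y where "y = x /\<^sub>R norm x"
    have y: "norm y = 1"
      using that by (simp add: y_def)
    have "\<bar>y \<bullet> ((B - A) *v y)\<bar> \<le> norm (B - A)"
      using Cauchy_Schwarz_ineq2[of y "(B - A) *v y"] norm_matrix_vector_mult_le[of "B - A" y] y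
      by simp
    moreover have "c \<le> y \<bullet> (A *v y)"
      using x0(2)[of y] y by (simp add: c_def)
    ultimately have "0 < y \<bullet> (B *v y)"
      using that(1) by (simp add: dist_norm matrix_vector_mult_diff_rdistrib inner_diff_right)
    then show ?thesis
      using that(2) by (simp add: y_def matrix_vector_mult_scaleR zero_less_mult_iff)
  qed
  ultimately show "\<exists>e>0. \<forall>B. dist B A < e \<longrightarrow> B \<in> {A. \<forall>x. x \<noteq> 0 \<longrightarrow> 0 < x \<bullet> (A *v x)}"
    by blast
qed

text \<open>Writing \<open>A = R ** transpose R\<close>, submultiplicativity gives
  \<open>norm A \<le> (norm R)\<^sup>2\<close>, and this square is the trace of
  \<open>A\<close>.\<close>

lemma norm_sym_pd_le_trace:
  fixes A :: "real^'n^'n"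
  assumes "sym_pd A"
  shows "norm A \<le> trace A"
proof -
  obtain T :: "real^'n^'n" where T: "invertible T" "transpose T ** A ** T = mat 1"
    by (rule sym_pd_factorization[OF assms])
  define R where "R = transpose (matrix_inv T)"
  have "invertible (transpose T)"
    using T(1) by (simp add: transpose_invertible)
  then have "A = R ** (transpose T ** A ** T) ** matrix_inv T"
    using T(1) by (simp add: R_def transpose_matrix_inv matrix_mul_assoc[symmetric] matrix_inv_cancel
        matrix_inv_right_left)
  then have A: "A = R ** transpose R"
    unfolding T(2) by (simp add: R_def)
  have "norm A \<le> norm R * norm (transpose R)"
    unfolding A by (rule norm_matrix_matrix_mult_le)
  also have "norm (transpose R) = norm R"
    by (simp add: norm_eq_sqrt_inner inner_matrix_eq_trace trace_mul_sym[of R])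
  also have "norm R * norm R = trace A"
    by (metis A inner_matrix_eq_trace power2_norm_eq_inner power2_eq_square)
  finally show ?thesis .
qed

section \<open>The domain\<close>

lemma transpose_schur_l2:
  assumes "transpose X = X" "invertible X"
  shows "transpose (schur_l2 X Y) = schur_l2 X Y"
  by (simp add: schur_l2_def linear_diff[OF linear_transpose]
      linear_sum[OF linear_transpose]
      matrix_transpose_mul transpose_matrix_inv[OF assms(2)] assms(1) matrix_mul_assoc)

text \<open>The quadratic form of the arrow matrix with diagonal blocks \<^term>\<open>X\<close> and first
  off-diagonal block row \<^term>\<open>- Y\<close>. It is linear in \<^term>\<open>X\<close> and \<^term>\<open>Y\<close>,
  and its Schur complement is \<^const>\<open>schur_l2\<close>.\<close>
definition arrow_form :: "real^'n^'n \<Rightarrow> real^'n^'n^'k::finite \<Rightarrow> real^'n \<Rightarrow> real^'n^'k \<Rightarrow> real" where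
  "arrow_form X Y x z =
    x \<bullet> (X *v x) - 2 * (\<Sum>i\<in>UNIV. x \<bullet> (Y $ i *v z $ i)) + (\<Sum>i\<in>UNIV. z $ i \<bullet> (X *v z $ i))"

text \<open>Completing the square in each \<open>z $ i\<close>; the centre is
  \<open>matrix_inv X\<close> applied to \<open>x v* Y $ i\<close>, which is the transpose of
  \<open>Y $ i\<close> applied to \<open>x\<close>.\<close>

lemma arrow_form_schur:
  fixes Y :: "real^'n^'n^'k::finite"
  assumes "transpose X = X" "invertible X"
  shows "arrow_form X Y x z = x \<bullet> (schur_l2 X Y *v x)
    + (\<Sum>i\<in>UNIV. (z $ i - matrix_inv X *v (x v* Y $ i)) \<bullet> (X *v (z $ i - matrix_inv X *v (x v* Y $ i))))"
proof -
  define u where "u i = matrix_inv X *v (x v* Y $ i)" for i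
  have Xu: "X *v u i = x v* Y $ i" for i
    by (simp add: u_def matrix_vector_mul_assoc matrix_inv_right_left[OF assms(2)])
  have "(z $ i - u i) \<bullet> (X *v (z $ i - u i))
     = z $ i \<bullet> (X *v z $ i) - 2 * (x \<bullet> (Y $ i *v z $ i)) + x \<bullet> (Y $ i *v u i)" for i
  proof -
    have "u i \<bullet> (X *v z $ i) = x \<bullet> (Y $ i *v z $ i)"
      using inner_matrix_vector_sym[OF assms(1), of "u i"]
      by (metis Xu dot_lmul_matrix inner_commute)
    moreover have "z $ i \<bullet> (X *v u i) = x \<bullet> (Y $ i *v z $ i)"
      by (metis Xu dot_lmul_matrix inner_commute)
    moreover have "u i \<bullet> (X *v u i) = x \<bullet> (Y $ i *v u i)"
      by (metis Xu dot_lmul_matrix inner_commute)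
    ultimately show ?thesis
      by (simp add: matrix_vector_mult_diff_distrib inner_diff_left inner_diff_right)
  qed
  moreover have "x \<bullet> (schur_l2 X Y *v x) = x \<bullet> (X *v x) - (\<Sum>i\<in>UNIV. x \<bullet> (Y $ i *v u i))"
  proof -
    have "(\<Sum>i\<in>UNIV. Y $ i ** matrix_inv X ** transpose (Y $ i)) *v x = (\<Sum>i\<in>UNIV. Y $ i *v u i)"
      by (subst linear_sum[where f = "\<lambda>A. A *v x"])
        (auto intro!: linearI simp: u_def matrix_vector_mul_assoc[symmetric] matrix_vector_mult_add_rdistrib
          scaleR_matrix_vector_assoc)
    then show ?thesis
      by (simp add: schur_l2_def matrix_vector_mult_diff_rdistrib inner_diff_right inner_sum_right)
  qed
  ultimately show ?thesis
    by (simp add: arrow_form_def u_def[symmetric] sum.distrib sum_subtractf sum_distrib_left)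
qed

text \<open>Replaces the nonlinear Schur condition by positivity of forms that are linear in
  \<open>(X, Y)\<close>, from which convexity of the domain follows.\<close>

lemma l2_dom_iff_arrow_form:
  fixes Y :: "real^'n^'n^'k::finite"
  shows "(X, Y) \<in> l2_dom \<longleftrightarrow>
    transpose X = X \<and> (\<forall>x z. x \<noteq> 0 \<or> z \<noteq> 0 \<longrightarrow> 0 < arrow_form X Y x z)"
proof (intro iffI conjI allI impI)
  assume "(X, Y) \<in> l2_dom"
  then have X: "sym_pd X" and S: "sym_pd (schur_l2 X Y)"
    by (auto simp: l2_dom_def)
  then show sym: "transpose X = X"
    by (simp add: sym_pd_def)
  fix x :: "real^'n" and z :: "real^'n^'k"
  assume xz: "x \<noteq> 0 \<or> z \<noteq> 0"
  define w where "w i = z $ i - matrix_inv X *v (x v* Y $ i)" for i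
  have eq: "arrow_form X Y x z = x \<bullet> (schur_l2 X Y *v x) + (\<Sum>i\<in>UNIV. w i \<bullet> (X *v w i))"
    by (simp add: arrow_form_schur[OF sym sym_pd_imp_invertible[OF X]] w_def)
  have nn: "0 \<le> w i \<bullet> (X *v w i)" for i
    using X by (cases "w i = 0") (auto simp: sym_pd_def less_imp_le)
  show "0 < arrow_form X Y x z"
  proof (cases "x = 0")
    case False
    then show ?thesis
      unfolding eq using S nn by (auto simp: sym_pd_def intro!: add_pos_nonneg sum_nonneg)
  next
    case True
    with xz obtain i where "z $ i \<noteq> 0"
      by (auto simp: vec_eq_iff)
    then have "0 < w i \<bullet> (X *v w i)"
      using X True by (auto simp: w_def sym_pd_def)
    then show ?thesis
      unfolding eq using nn True by (auto intro!: sum_pos2[of _ i])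
  qed
next
  assume R: "transpose X = X \<and> (\<forall>x z. x \<noteq> 0 \<or> z \<noteq> 0 \<longrightarrow> 0 < arrow_form X Y x z)"
  \<comment> \<open>With first argument zero and every \<open>z $ i\<close> equal to
    \<open>x\<close>, the arrow form is \<open>CARD('k)\<close> times the form of
    \<open>X\<close>.\<close>
  have "0 < x \<bullet> (X *v x)" if "x \<noteq> 0" for x
    using R[THEN conjunct2, rule_format, of 0 "\<chi> i. x"] that
    by (simp add: arrow_form_def vec_eq_iff zero_less_mult_iff)
  with R have X: "sym_pd X"
    by (auto simp: sym_pd_def)
  note inv = sym_pd_imp_invertible[OF X]
  \<comment> \<open>Placing \<open>z\<close> at the centre of the completed squares makes them
    vanish and leaves only the Schur complement.\<close>
  have "0 < x \<bullet> (schur_l2 X Y *v x)" if "x \<noteq> 0" for x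
    using R[THEN conjunct2, rule_format, of x "\<chi> i. matrix_inv X *v (x v* Y $ i)"] that R
    by (simp add: arrow_form_schur inv)
  then have "sym_pd (schur_l2 X Y)"
    using R inv by (simp add: sym_pd_def transpose_schur_l2)
  with X show "(X, Y) \<in> l2_dom"
    by (simp add: l2_dom_def)
qed

lemma convex_l2_dom: "convex (l2_dom :: ((real^'n^'n) \<times> (real^'n^'n^'k::finite)) set)"
proof (rule convexI, clarify)
  fix X X' :: "real^'n^'n" and Y Y' :: "real^'n^'n^'k" and u v :: real
  assume 1: "(X, Y) \<in> l2_dom" and 2: "(X', Y') \<in> l2_dom" and uv: "0 \<le> u" "0 \<le> v" "u + v = 1"
  have eq: "arrow_form (u *\<^sub>R X + v *\<^sub>R X') (u *\<^sub>R Y + v *\<^sub>R Y') x z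
      = u * arrow_form X Y x z + v * arrow_form X' Y' x z" for x and z :: "real^'n^'k"
    by (simp add: arrow_form_def matrix_vector_mult_add_rdistrib scaleR_matrix_vector_assoc[symmetric]
        inner_add_right sum.distrib sum_distrib_left algebra_simps)
  have "0 < u * a + v * b" if "0 < a" "0 < b" for a b :: real
    using uv that by (cases "u = 0") (auto intro: add_pos_nonneg)
  then show "u *\<^sub>R (X, Y) + v *\<^sub>R (X', Y') \<in> l2_dom"
    using 1 2 unfolding scaleR_Pair add_Pair l2_dom_iff_arrow_form eq
    by (auto simp: linear_add[OF linear_transpose] transpose_scalar)
qed

section \<open>Relative openness of the domain and the interior of its closure\<close>

lemma isCont_schur_l2:
  fixes p :: "(real^'n^'n) \<times> (real^'n^'n^'k::finite)"
  assumes "invertible (fst p)"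
  shows "isCont (\<lambda>p. schur_l2 (fst p) (snd p)) p"
proof -
  have "isCont (\<lambda>p::(real^'n^'n) \<times> (real^'n^'n^'k). matrix_inv (fst p)) p"
    by (rule isCont_o2[OF isCont_fst[OF continuous_ident] continuous_matrix_inv[OF assms]])
  then show ?thesis
    unfolding schur_l2_def
    by (intro continuous_diff continuous_sum matmul.continuous isCont_fst continuous_ident isCont_snd
        bounded_linear.continuous[OF bounded_linear_transpose] bounded_linear.continuous[OF bounded_linear_vec_nth])
qed

text \<open>Positivity of the form, without symmetry, is an open condition on both matrices.
  Intersecting with \<open>sym_space\<close> restores symmetry of the first block, and the Schur
  complement inherits it.\<close>

lemma openin_l2_dom:
  "openin (top_of_set sym_space) (l2_dom :: ((real^'n^'n) \<times> (real^'n^'n^'k::finite)) set)"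
proof -
  define P where "P = {A::real^'n^'n. \<forall>x. x \<noteq> 0 \<longrightarrow> 0 < x \<bullet> (A *v x)}"
  define U where "U = {p :: (real^'n^'n) \<times> (real^'n^'n^'k). fst p \<in> P}"
  have "open P"
    unfolding P_def by (rule open_posdef)
  have "open U"
    using continuous_open_vimage[OF \<open>open P\<close>, of fst] by (simp add: U_def vimage_def continuous_intros)
  moreover have "continuous_on U (\<lambda>p. schur_l2 (fst p) (snd p))"
    by (intro continuous_at_imp_continuous_on ballI isCont_schur_l2 posdef_imp_invertible)
      (simp add: U_def P_def)
  ultimately have "open (U \<inter> (\<lambda>p. schur_l2 (fst p) (snd p)) -` P)"
    using \<open>open P\<close> by (blast intro: continuous_open_preimage)
  moreover have "l2_dom = sym_space \<inter> (U \<inter> (\<lambda>p. schur_l2 (fst p) (snd p)) -` P)"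
    by (auto simp: l2_dom_def sym_space_def U_def P_def sym_pd_def transpose_schur_l2 posdef_imp_invertible)
  ultimately show ?thesis
    by (auto simp: openin_open)
qed

lemma subspace_sym_space: "subspace sym_space"
  by (auto simp: sym_space_def subspace_def transpose_scalar zero_prod_def
      linear_add[OF linear_transpose]
      linear_0[OF linear_transpose])

lemma l2_dom_subset_sym_space: "l2_dom \<subseteq> sym_space"
  by (auto simp: l2_dom_def sym_space_def sym_pd_def)

lemma mat_1_in_l2_dom: "(mat 1, 0) \<in> l2_dom"
proof -
  have "sym_pd (mat 1 :: real^'n^'n)"
    by (simp add: sym_pd_def)
  then show ?thesis
    by (simp add: l2_dom_def schur_l2_def)
qed

text \<open>A nonempty relatively open subset of \<open>E\<close> has affine hull \<open>E\<close>,
  so the interior relative to \<open>E\<close> is the relative interior, and convexity makes that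
  insensitive to closure.\<close>

lemma interior_of_closure_convex_openin:
  fixes D :: "'a::euclidean_space set"
  assumes "affine E" "convex D" "openin (top_of_set E) D" "D \<noteq> {}"
  shows "(top_of_set E) interior_of (closure D) = D"
proof -
  have hull: "affine hull D = E"
    using assms affine_hull_openin[of E D] by (simp add: hull_same)
  have "(top_of_set E) interior_of (closure D) = rel_interior (closure D)"
    unfolding rel_interior_def interior_of_def by (simp add: hull)
  also have "\<dots> = D"
    using assms by (simp add: convex_rel_interior_closure rel_interior_openin hull)
  finally show ?thesis .
qed

section \<open>Derivatives of the barrier\<close>

type_synonym ('n, 'k) l2_space = "(real^'n^'n) \<times> (real^'n^'n^'k)"

text \<open>The product \<open>l2_W p h i ** matrix_inv (fst p)\<close> is the derivative of
  \<open>snd p $ i ** matrix_inv (fst p)\<close> along \<open>h\<close>.\<close>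

definition l2_W :: "('n::finite, 'k) l2_space \<Rightarrow> ('n, 'k) l2_space \<Rightarrow> 'k::finite \<Rightarrow> real^'n^'n" where
  "l2_W p h i = snd h $ i - snd p $ i ** matrix_inv (fst p) ** fst h"

text \<open>For symmetric \<^term>\<open>fst p\<close> and \<^term>\<open>fst h\<close> this is the transpose of \<^const>\<open>l2_W\<close>; kept
  separate, all derivative formulas below also hold without symmetry.\<close>
definition l2_V :: "('n::finite, 'k) l2_space \<Rightarrow> ('n, 'k) l2_space \<Rightarrow> 'k::finite \<Rightarrow> real^'n^'n" where
  "l2_V p h i = transpose (snd h $ i) - fst h ** matrix_inv (fst p) ** transpose (snd p $ i)"

definition D_schur :: "('n::finite, 'k::finite) l2_space \<Rightarrow> ('n, 'k) l2_space \<Rightarrow> real^'n^'n" where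
  "D_schur p h = fst h - (\<Sum>i\<in>UNIV. l2_W p h i ** matrix_inv (fst p) ** transpose (snd p $ i)
      + snd p $ i ** matrix_inv (fst p) ** transpose (snd h $ i))"

definition D2_schur :: "('n::finite, 'k::finite) l2_space \<Rightarrow> ('n, 'k) l2_space \<Rightarrow> ('n, 'k) l2_space \<Rightarrow> real^'n^'n" where
  "D2_schur p h k = - (\<Sum>i\<in>UNIV. l2_W p h i ** matrix_inv (fst p) ** l2_V p k i
      + l2_W p k i ** matrix_inv (fst p) ** l2_V p h i)"

definition sandwich :: "('n::finite, 'k::finite) l2_space \<Rightarrow> ('n, 'k) l2_space \<Rightarrow> ('n, 'k) l2_space \<Rightarrow> ('n, 'k) l2_space
    \<Rightarrow> 'k \<Rightarrow> real^'n^'n" where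
  "sandwich p h k l i =
    l2_W p h i ** matrix_inv (fst p) ** fst k ** matrix_inv (fst p) ** l2_V p l i"

text \<open>One \<open>sandwich\<close> for each of the six orderings of \<open>h\<close>,
  \<open>k\<close>, \<open>l\<close>. The minus signs from differentiating \<open>l2_W\<close>,
  \<open>l2_V\<close> and the inverse cancel the one in \<open>D2_schur\<close>.\<close>

definition D3_schur :: "('n::finite, 'k::finite) l2_space \<Rightarrow> ('n, 'k) l2_space \<Rightarrow> ('n, 'k) l2_space
    \<Rightarrow> ('n, 'k) l2_space \<Rightarrow> real^'n^'n" where
  "D3_schur p h k l = (\<Sum>i\<in>UNIV. sandwich p l h k i + sandwich p h l k i + sandwich p h k l i
      + (sandwich p l k h i + sandwich p k l h i + sandwich p k h l i))"

abbreviation schur_p :: "('n::finite, 'k::finite) l2_space \<Rightarrow> real^'n^'n" where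
  "schur_p p \<equiv> schur_l2 (fst p) (snd p)"

lemma has_derivative_matrix_inv_fst:
  fixes p :: "(real^'n^'n) \<times> 'a::real_normed_vector"
  assumes "invertible (fst p)"
  shows "((\<lambda>p. matrix_inv (fst p)) has_derivative
    (\<lambda>h. - (matrix_inv (fst p) ** fst h ** matrix_inv (fst p)))) (at p)"
  by (intro has_derivative_matrix_inv has_derivative_fst has_derivative_ident assms)

lemma has_derivative_snd_nth: "((\<lambda>p. snd p $ i) has_derivative (\<lambda>h. snd h $ i)) (at p)"
  by (intro bounded_linear.has_derivative[OF bounded_linear_vec_nth] has_derivative_snd has_derivative_ident)

lemmas matmul_linear = matmul.add_left matmul.add_right matmul.diff_left matmul.diff_right
  matmul.minus_left matmul.minus_right matrix_mul_assoc

text \<open>These rules follow the syntax of an expression; under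
  \<open>has_derivative_eq_rhs\<close> they build the derivative schematically, and only a matrix
  identity remains.\<close>

lemmas l2_derivative_rules = has_derivative_const has_derivative_fst[OF has_derivative_ident]
  has_derivative_snd_nth has_derivative_matrix_inv_fst has_derivative_matrix_mult has_derivative_transpose
  has_derivative_add has_derivative_diff has_derivative_minus has_derivative_sum has_derivative_trace

text \<open>The derivative of \<open>l2_W\<close> contains \<open>l2_W\<close> again, which keeps
  the second and third derivatives of the Schur complement short.\<close>

lemma has_derivative_l2_W:
  fixes p :: "('n::finite, 'k::finite) l2_space"
  assumes "invertible (fst p)"
  shows "((\<lambda>p. l2_W p h i) has_derivative (\<lambda>k. - (l2_W p k i ** matrix_inv (fst p) ** fst h))) (at p)"
  unfolding l2_W_def
  by (rule has_derivative_eq_rhs, (rule l2_derivative_rules assms)+)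
    (simp add: fun_eq_iff matmul_linear)

lemma has_derivative_l2_V:
  fixes p :: "('n::finite, 'k::finite) l2_space"
  assumes "invertible (fst p)"
  shows "((\<lambda>p. l2_V p h i) has_derivative (\<lambda>k. - (fst h ** matrix_inv (fst p) ** l2_V p k i))) (at p)"
  unfolding l2_V_def
  by (rule has_derivative_eq_rhs, (rule l2_derivative_rules assms)+)
    (simp add: fun_eq_iff matmul_linear)

lemma has_derivative_schur:
  fixes p :: "('n::finite, 'k::finite) l2_space"
  assumes "invertible (fst p)"
  shows "(schur_p has_derivative D_schur p) (at p)"
  unfolding schur_l2_def
  by (rule has_derivative_eq_rhs, (rule l2_derivative_rules assms)+)
    (simp add: fun_eq_iff matmul_linear D_schur_def l2_W_def algebra_simps)

lemma has_derivative_D_schur: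
  fixes p :: "('n::finite, 'k::finite) l2_space"
  assumes "invertible (fst p)"
  shows "((\<lambda>p. D_schur p h) has_derivative D2_schur p h) (at p)"
  unfolding D_schur_def
  by (rule has_derivative_eq_rhs, (rule l2_derivative_rules has_derivative_l2_W assms)+)
    (simp add: fun_eq_iff matmul_linear D2_schur_def l2_W_def l2_V_def algebra_simps)

lemma has_derivative_D2_schur:
  fixes p :: "('n::finite, 'k::finite) l2_space"
  assumes "invertible (fst p)"
  shows "((\<lambda>p. D2_schur p h k) has_derivative D3_schur p h k) (at p)"
  unfolding D2_schur_def
  by (rule has_derivative_eq_rhs, (rule l2_derivative_rules has_derivative_l2_W has_derivative_l2_V assms)+)
    (simp add: fun_eq_iff matmul_linear D3_schur_def sandwich_def sum_negf[symmetric] algebra_simps)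

section \<open>First three derivatives of the barrier function\<close>

definition DF_hat :: "('n::finite, 'k::finite) l2_space \<Rightarrow> ('n, 'k) l2_space \<Rightarrow> real" where
  "DF_hat p h = - trace (matrix_inv (schur_p p) ** D_schur p h) - trace (matrix_inv (fst p) ** fst h)"

definition D2F_hat :: "('n::finite, 'k::finite) l2_space \<Rightarrow> ('n, 'k) l2_space \<Rightarrow> ('n, 'k) l2_space \<Rightarrow> real" where
  "D2F_hat p h k =
    trace (matrix_inv (schur_p p) ** D_schur p k ** matrix_inv (schur_p p) ** D_schur p h)
    - trace (matrix_inv (schur_p p) ** D2_schur p h k)
    + trace (matrix_inv (fst p) ** fst k ** matrix_inv (fst p) ** fst h)"

definition D3F_hat :: "('n::finite, 'k::finite) l2_space \<Rightarrow> ('n, 'k) l2_space \<Rightarrow> ('n, 'k) l2_space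
    \<Rightarrow> ('n, 'k) l2_space \<Rightarrow> real" where
  "D3F_hat p h k l = (let Q = matrix_inv (schur_p p); R = matrix_inv (fst p) in
    - trace (Q ** D_schur p l ** Q ** D_schur p k ** Q ** D_schur p h)
    - trace (Q ** D_schur p k ** Q ** D_schur p l ** Q ** D_schur p h)
    + trace (Q ** D2_schur p k l ** Q ** D_schur p h)
    + trace (Q ** D_schur p k ** Q ** D2_schur p h l)
    + trace (Q ** D_schur p l ** Q ** D2_schur p h k)
    - trace (Q ** D3_schur p h k l)
    - trace (R ** fst l ** R ** fst k ** R ** fst h)
    - trace (R ** fst k ** R ** fst l ** R ** fst h))"

lemma has_derivative_F_hat:
  fixes p :: "('n::finite, 'k::finite) l2_space"
  assumes "0 < det (fst p)" "0 < det (schur_p p)"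
  shows "(F_hat has_derivative DF_hat p) (at p)"
proof -
  have "invertible (fst p)"
    using assms(1) by (simp add: invertible_det_nz)
  then show ?thesis
    unfolding F_hat_def[abs_def]
    by (intro has_derivative_eq_rhs[OF has_derivative_diff[OF has_derivative_minus[OF
        has_derivative_ln_det[OF has_derivative_schur assms(2)]]
        has_derivative_ln_det[OF has_derivative_fst[OF has_derivative_ident] assms(1)]]])
      (auto simp: DF_hat_def)
qed

lemma has_derivative_DF_hat:
  fixes p :: "('n::finite, 'k::finite) l2_space"
  assumes "invertible (fst p)" "invertible (schur_p p)"
  shows "((\<lambda>p. DF_hat p h) has_derivative D2F_hat p h) (at p)"
  unfolding DF_hat_def
  by (rule has_derivative_eq_rhs, (rule l2_derivative_rules has_derivative_D_schur
        has_derivative_matrix_inv[OF has_derivative_schur] assms)+)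
    (simp add: fun_eq_iff matmul_linear D2F_hat_def linear_neg[OF linear_trace]
      trace_add trace_sub)

lemma has_derivative_D2F_hat:
  fixes p :: "('n::finite, 'k::finite) l2_space"
  assumes "invertible (fst p)" "invertible (schur_p p)"
  shows "((\<lambda>p. D2F_hat p h k) has_derivative D3F_hat p h k) (at p)"
  unfolding D2F_hat_def
  by (rule has_derivative_eq_rhs, (rule l2_derivative_rules has_derivative_D_schur has_derivative_D2_schur
        has_derivative_matrix_inv[OF has_derivative_schur] assms)+)
    (simp add: fun_eq_iff matmul_linear D3F_hat_def Let_def
      linear_neg[OF linear_trace] trace_add trace_sub)

lemma isCont_D3F_hat:
  fixes p :: "('n::finite, 'k::finite) l2_space"
  assumes "invertible (fst p)" "invertible (schur_p p)"
  shows "isCont (\<lambda>p. D3F_hat p h k l) p"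
proof -
  note rules = continuous_add continuous_diff continuous_minus continuous_sum matmul.continuous
    bounded_linear.continuous[OF bounded_linear_trace] continuous_const
    has_derivative_continuous[OF has_derivative_l2_W[OF assms(1)]]
    has_derivative_continuous[OF has_derivative_l2_V[OF assms(1)]]
    has_derivative_continuous[OF has_derivative_matrix_inv_fst[OF assms(1)]]
    has_derivative_continuous[OF has_derivative_D_schur[OF assms(1)]]
    has_derivative_continuous[OF has_derivative_D2_schur[OF assms(1)]]
    has_derivative_continuous[OF has_derivative_matrix_inv[OF has_derivative_schur[OF assms(1)] assms(2)]]
  have "isCont (\<lambda>p. sandwich p h k l i) p" for h k l :: "('n, 'k) l2_space" and i
    unfolding sandwich_def by (intro rules)
  then have "isCont (\<lambda>p. D3_schur p h k l) p"
    unfolding D3_schur_def by (intro rules)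
  then show ?thesis
    unfolding D3F_hat_def Let_def by (intro rules)
qed

section \<open>Self-concordance\<close>

text \<open>For \<open>M\<close> the symmetric matrix with rows \<open>(\<alpha>, \<omega>)\<close> and \<open>(\<omega>, \<beta>)\<close>, where \<open>s = \<omega>\<^sup>2\<close>, this is
  \<open>trace (M\<^sup>3) \<le> (trace (M\<^sup>2)) powr (3/2)\<close>; with \<open>t = trace M\<close> and \<open>d = det M\<close> the difference
  of the squares is \<open>d\<^sup>2 * (3 * t\<^sup>2 - 8 * d)\<close>.\<close>
lemma trace_cube_le_2x2:
  fixes \<alpha> \<beta> s :: real
  assumes "0 \<le> \<alpha>" "0 \<le> \<beta>" "0 \<le> s"
  shows "\<alpha>^3 + \<beta>^3 + 3 * s * (\<alpha> + \<beta>) \<le> (\<alpha>\<^sup>2 + 2 * s + \<beta>\<^sup>2) powr (3/2)"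
proof (rule power2_le_imp_le)
  define q where "q = \<alpha>\<^sup>2 + 2 * s + \<beta>\<^sup>2"
  define d where "d = \<alpha> * \<beta> - s"
  have "0 \<le> q"
    using assms by (simp add: q_def)
  have "3 * (\<alpha> + \<beta>)\<^sup>2 - 8 * d = 3 * (\<alpha> - \<beta>)\<^sup>2 + 4 * (\<alpha> * \<beta>) + 8 * s"
    by (simp add: d_def power2_eq_square algebra_simps)
  also have "\<dots> \<ge> 0"
    using assms by simp
  finally have "0 \<le> d\<^sup>2 * (3 * (\<alpha> + \<beta>)\<^sup>2 - 8 * d)"
    by simp
  also have "\<dots> = q ^ 3 - (\<alpha>^3 + \<beta>^3 + 3 * s * (\<alpha> + \<beta>))\<^sup>2"
    by (simp add: q_def d_def) algebra
  finally have "(\<alpha>^3 + \<beta>^3 + 3 * s * (\<alpha> + \<beta>))\<^sup>2 \<le> q ^ 3"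
    by simp
  also have "q ^ 3 = (q powr (3/2))\<^sup>2"
    using \<open>0 \<le> q\<close> by (simp add: power2_eq_square powr_add[symmetric])
  finally show "(\<alpha>^3 + \<beta>^3 + 3 * s * (\<alpha> + \<beta>))\<^sup>2 \<le> ((\<alpha>\<^sup>2 + 2 * s + \<beta>\<^sup>2) powr (3/2))\<^sup>2"
    by (simp add: q_def)
qed simp

text \<open>Cauchy--Schwarz and submultiplicativity bound the four terms by norms; what remains is
  \<open>trace_cube_le_2x2\<close> at \<open>\<alpha> = norm a\<close>,
  \<open>\<beta> = norm b\<close>, with \<open>s\<close> the sum of the squared norms of the
  \<open>w i\<close>.\<close>

lemma self_concordance_inequality:
  fixes a b :: "real^'n^'n" and w :: "'k::finite \<Rightarrow> real^'n^'n"
  shows "\<bar>2 * (a \<bullet> (a ** a)) + 6 * (\<Sum>i\<in>UNIV. (a ** w i) \<bullet> w i) + 6 * (\<Sum>i\<in>UNIV. (w i ** b) \<bullet> w i)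
      + 2 * (b \<bullet> (b ** b))\<bar>
    \<le> 2 * ((norm a)\<^sup>2 + 2 * (\<Sum>i\<in>UNIV. (norm (w i))\<^sup>2) + (norm b)\<^sup>2) powr (3/2)"
proof -
  define s where "s = (\<Sum>i\<in>UNIV. (norm (w i))\<^sup>2)"
  have cube: "\<bar>c \<bullet> (c ** c)\<bar> \<le> norm c ^ 3" for c :: "real^'n^'n"
  proof -
    have "\<bar>c \<bullet> (c ** c)\<bar> \<le> norm c * norm (c ** c)"
      by (rule Cauchy_Schwarz_ineq2)
    also have "\<dots> \<le> norm c * (norm c * norm c)"
      by (intro mult_left_mono norm_matrix_matrix_mult_le norm_ge_zero)
    finally show ?thesis by (simp add: power3_eq_cube mult_ac)
  qed
  have "\<bar>(a ** w i) \<bullet> w i\<bar> \<le> norm a * (norm (w i))\<^sup>2" for i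
  proof -
    have "\<bar>(a ** w i) \<bullet> w i\<bar> \<le> norm (a ** w i) * norm (w i)"
      by (rule Cauchy_Schwarz_ineq2)
    also have "\<dots> \<le> norm a * norm (w i) * norm (w i)"
      by (intro mult_right_mono norm_matrix_matrix_mult_le norm_ge_zero)
    finally show ?thesis by (simp add: power2_eq_square mult_ac)
  qed
  then have A: "\<bar>\<Sum>i\<in>UNIV. (a ** w i) \<bullet> w i\<bar> \<le> norm a * s"
    unfolding s_def sum_distrib_left by (intro order_trans[OF sum_abs] sum_mono)
  have "\<bar>(w i ** b) \<bullet> w i\<bar> \<le> norm b * (norm (w i))\<^sup>2" for i
  proof -
    have "\<bar>(w i ** b) \<bullet> w i\<bar> \<le> norm (w i ** b) * norm (w i)"
      by (rule Cauchy_Schwarz_ineq2)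
    also have "\<dots> \<le> norm (w i) * norm b * norm (w i)"
      by (intro mult_right_mono norm_matrix_matrix_mult_le norm_ge_zero)
    finally show ?thesis by (simp add: power2_eq_square mult_ac)
  qed
  then have B: "\<bar>\<Sum>i\<in>UNIV. (w i ** b) \<bullet> w i\<bar> \<le> norm b * s"
    unfolding s_def sum_distrib_left by (intro order_trans[OF sum_abs] sum_mono)
  have "0 \<le> s"
    by (simp add: s_def sum_nonneg)
  from trace_cube_le_2x2[OF norm_ge_zero[of a] norm_ge_zero[of b] this]
  have "norm a ^ 3 + norm b ^ 3 + 3 * (norm a * s) + 3 * (norm b * s)
      \<le> ((norm a)\<^sup>2 + 2 * s + (norm b)\<^sup>2) powr (3/2)"
    by (simp add: algebra_simps)
  then show ?thesis
    using cube[of a] cube[of b] A B unfolding s_def[symmetric] by linarith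
qed

lemma l2_V_eq_transpose_W:
  fixes p h :: "('n::finite, 'k::finite) l2_space"
  assumes "p \<in> sym_space" "h \<in> sym_space" "invertible (fst p)"
  shows "l2_V p h i = transpose (l2_W p h i)"
  using assms by (auto simp: l2_V_def l2_W_def linear_diff[OF linear_transpose] matrix_transpose_mul
      transpose_matrix_inv sym_space_def matrix_mul_assoc)

lemma transpose_D_schur:
  fixes p h :: "('n::finite, 'k::finite) l2_space"
  assumes "p \<in> sym_space" "h \<in> sym_space" "invertible (fst p)"
  shows "transpose (D_schur p h) = D_schur p h"
proof -
  have sym: "transpose (fst p) = fst p" "transpose (fst h) = fst h"
    using assms by (auto simp: sym_space_def)
  show ?thesis
    unfolding D_schur_def l2_W_def
    by (simp add: linear_diff[OF linear_transpose] linear_add[OF linear_transpose] linear_sum[OF linear_transpose]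
        matrix_transpose_mul transpose_matrix_inv[OF assms(3)] sym matmul_linear algebra_simps)
qed

lemma trace_mult_D2_schur:
  "trace (M ** D2_schur p h h) = - 2 * (\<Sum>i\<in>UNIV. trace (M ** l2_W p h i ** matrix_inv (fst p) ** l2_V p h i))"
  unfolding D2_schur_def matmul.minus_right matmul.sum_right matmul.add_right linear_neg[OF linear_trace]
    linear_sum[OF linear_trace] trace_add matrix_mul_assoc sum.distrib by simp

text \<open>On the diagonal the six orderings coincide, hence the factor 6.\<close>

lemma trace_mult_D3_schur:
  "trace (M ** D3_schur p h h h) = 6 * (\<Sum>i\<in>UNIV. trace (M ** sandwich p h h h i))"
  unfolding D3_schur_def matmul.sum_right matmul.add_right linear_sum[OF linear_trace] trace_add
    sum.distrib by simp

text \<open>Splitting the two inverses as \<open>T ** transpose T\<close> and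
  \<open>R ** transpose R\<close>, cyclicity of the trace regroups every product into the
  congruences \<open>a\<close>, \<open>b\<close> and \<open>w i\<close>.\<close>

lemma F_hat_derivatives_normal_form:
  fixes p h :: "('n::finite, 'k::finite) l2_space"
  assumes p: "p \<in> l2_dom" and h: "h \<in> sym_space"
  obtains a b :: "real^'n^'n" and w :: "'k \<Rightarrow> real^'n^'n" where
    "DF_hat p h = - trace a - trace b"
    "D2F_hat p h h = (norm a)\<^sup>2 + 2 * (\<Sum>i\<in>UNIV. (norm (w i))\<^sup>2) + (norm b)\<^sup>2"
    "D3F_hat p h h h = - (2 * (a \<bullet> (a ** a)) + 6 * (\<Sum>i\<in>UNIV. (a ** w i) \<bullet> w i)
       + 6 * (\<Sum>i\<in>UNIV. (w i ** b) \<bullet> w i) + 2 * (b \<bullet> (b ** b)))"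
proof -
  define D where "D = D_schur p h"
  define H where "H = fst h"
  have pd: "sym_pd (fst p)" "sym_pd (schur_p p)"
    using p by (auto simp: l2_dom_def)
  have inv: "invertible (fst p)"
    using pd(1) by (rule sym_pd_imp_invertible)
  have pE: "p \<in> sym_space"
    using p l2_dom_subset_sym_space by blast
  obtain R :: "real^'n^'n" where R: "matrix_inv (fst p) = R ** transpose R"
    by (rule sym_pd_factorization[OF pd(1)])
  obtain T :: "real^'n^'n" where T: "matrix_inv (schur_p p) = T ** transpose T"
    by (rule sym_pd_factorization[OF pd(2)])
  define W where "W i = l2_W p h i" for i
  have V: "l2_V p h i = transpose (W i)" for i
    unfolding W_def by (rule l2_V_eq_transpose_W[OF pE h inv])
  define a where "a = transpose T ** D ** T"
  define b where "b = transpose R ** H ** R"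
  \<comment> \<open>In the traces \<open>W i\<close> stands between the inverse of the Schur
    complement and the inverse of \<open>fst p\<close>, hence one factor from each
    splitting.\<close>
  define w where "w i = transpose T ** W i ** R" for i
  have sym: "transpose D = D" "transpose H = H"
    using transpose_D_schur[OF pE h inv] h by (auto simp: D_def H_def sym_space_def)
  \<comment> \<open>Only a leading \<open>T\<close> or \<open>R\<close> is moved to the end, so the
    rewriting stops at a product that starts with a transpose.\<close>
  note cyc = trace_mul_sym[of T] trace_mul_sym[of R]
  note [simp] = matrix_mul_assoc[symmetric] matrix_transpose_mul inner_matrix_eq_trace power2_norm_eq_inner sym
  note folds = D_def[symmetric] H_def[symmetric] W_def[symmetric] T R V
  have "DF_hat p h = - trace a - trace b"
    unfolding DF_hat_def folds by (simp add: a_def b_def cyc)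
  moreover have "D2F_hat p h h = (norm a)\<^sup>2 + 2 * (\<Sum>i\<in>UNIV. (norm (w i))\<^sup>2) + (norm b)\<^sup>2"
    unfolding D2F_hat_def trace_mult_D2_schur folds by (simp add: a_def b_def w_def cyc)
  moreover have "D3F_hat p h h h = - (2 * (a \<bullet> (a ** a)) + 6 * (\<Sum>i\<in>UNIV. (a ** w i) \<bullet> w i)
       + 6 * (\<Sum>i\<in>UNIV. (w i ** b) \<bullet> w i) + 2 * (b \<bullet> (b ** b)))"
  proof -
    \<comment> \<open>Rotates \<open>D2_schur\<close> to the last place, where
      \<open>trace_mult_D2_schur\<close> applies; the three mixed terms then agree and contribute -2
      each, giving the coefficient -6.\<close>
    have "trace (T ** transpose T ** D2_schur p h h ** (T ** transpose T) ** D)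
      = trace (T ** transpose T ** D ** (T ** transpose T) ** D2_schur p h h)"
      using trace_mul_sym[of "T ** transpose T ** D2_schur p h h" "T ** transpose T ** D"] by simp
    then show ?thesis
      unfolding D3F_hat_def Let_def folds
      unfolding trace_mult_D2_schur trace_mult_D3_schur sandwich_def folds
      by (simp add: a_def b_def w_def cyc)
  qed
  ultimately show ?thesis
    by (rule that)
qed

lemma F_hat_self_concordant:
  fixes p h :: "('n::finite, 'k::finite) l2_space"
  assumes p: "p \<in> l2_dom" and h: "h \<in> sym_space"
  shows "0 \<le> D2F_hat p h h"
    and "\<bar>D3F_hat p h h h\<bar> \<le> 2 * D2F_hat p h h powr (3/2)"
    and "(DF_hat p h)\<^sup>2 \<le> 2 * real CARD('n) * D2F_hat p h h"
proof -
  obtain a b :: "real^'n^'n" and w :: "'k \<Rightarrow> real^'n^'n" where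
    1: "DF_hat p h = - trace a - trace b" and
    2: "D2F_hat p h h = (norm a)\<^sup>2 + 2 * (\<Sum>i\<in>UNIV. (norm (w i))\<^sup>2) + (norm b)\<^sup>2" and
    3: "D3F_hat p h h h = - (2 * (a \<bullet> (a ** a)) + 6 * (\<Sum>i\<in>UNIV. (a ** w i) \<bullet> w i)
       + 6 * (\<Sum>i\<in>UNIV. (w i ** b) \<bullet> w i) + 2 * (b \<bullet> (b ** b)))"
    by (rule F_hat_derivatives_normal_form[OF assms])
  have w: "0 \<le> (\<Sum>i\<in>UNIV. (norm (w i))\<^sup>2)"
    by (simp add: sum_nonneg)
  then show "0 \<le> D2F_hat p h h"
    unfolding 2 by simp
  show "\<bar>D3F_hat p h h h\<bar> \<le> 2 * D2F_hat p h h powr (3/2)"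
    unfolding 2 3 abs_minus_cancel by (rule self_concordance_inequality)
  \<comment> \<open>The trace is the inner product with \<open>mat 1\<close>, whose squared norm is
    \<open>CARD('n)\<close>.\<close>
  have tr: "(trace c)\<^sup>2 \<le> real CARD('n) * (norm c)\<^sup>2" for c :: "real^'n^'n"
    using Cauchy_Schwarz_ineq[of c "mat 1"]
    by (simp add: inner_matrix_eq_trace[of _ "mat 1"] trace_I power2_norm_eq_inner mult.commute)
  \<comment> \<open>The 2 from squaring a sum of two traces is the factor 2 in the barrier
    parameter.\<close>
  have "(DF_hat p h)\<^sup>2 \<le> 2 * (trace a)\<^sup>2 + 2 * (trace b)\<^sup>2"
    unfolding 1 using zero_le_power2[of "trace a - trace b"] by (simp add: power2_eq_square algebra_simps)
  also have "\<dots> \<le> 2 * real CARD('n) * ((norm a)\<^sup>2 + (norm b)\<^sup>2)"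
    using tr[of a] tr[of b] by (simp add: algebra_simps)
  also have "\<dots> \<le> 2 * real CARD('n) * D2F_hat p h h"
    unfolding 2 using w by (intro mult_left_mono) auto
  finally show "(DF_hat p h)\<^sup>2 \<le> 2 * real CARD('n) * D2F_hat p h h" .
qed

section \<open>Convexity and boundary behaviour\<close>

text \<open>Restriction to a segment reduces this to the one-variable criterion. Only differences of
  points of \<open>D\<close> occur as directions in \<open>nonneg\<close>, because for
  \<open>F_hat\<close> nonnegativity is proved for directions in \<open>sym_space\<close>.\<close>

lemma convex_on_second_derivative_nonneg:
  fixes F :: "'a::real_normed_vector \<Rightarrow> real"
  assumes "convex D"
    and DF: "\<And>x. x \<in> D \<Longrightarrow> (F has_derivative DF x) (at x)"
    and D2F: "\<And>x h. x \<in> D \<Longrightarrow> ((\<lambda>y. DF y h) has_derivative D2F x h) (at x)"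
    and nonneg: "\<And>x y z. x \<in> D \<Longrightarrow> y \<in> D \<Longrightarrow> z \<in> D \<Longrightarrow> 0 \<le> D2F x (z - y) (z - y)"
  shows "convex_on D F"
proof (rule convex_onI)
  fix t x y
  assume t: "0 < t" "t < (1::real)" and xy: "x \<in> D" "y \<in> D"
  define h where "h = y - x"
  define \<gamma> where "\<gamma> s = x + s *\<^sub>R h" for s :: real
  have \<gamma>: "\<gamma> s \<in> D" if "s \<in> {0..1}" for s
  proof -
    have "\<gamma> s = (1 - s) *\<^sub>R x + s *\<^sub>R y"
      by (simp add: \<gamma>_def h_def algebra_simps)
    then show ?thesis
      using convexD[OF \<open>convex D\<close> xy, of "1 - s" s] that by simp
  qed
  have comp: "((\<lambda>s. G (\<gamma> s)) has_real_derivative G' h) (at s)"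
    if "(G has_derivative G') (at (\<gamma> s))" for G G' s
  proof -
    have "(\<gamma> has_derivative (\<lambda>r. r *\<^sub>R h)) (at s)"
      unfolding \<gamma>_def by (auto intro!: derivative_eq_intros)
    from has_derivative_compose[OF this that]
    show ?thesis
      unfolding has_field_derivative_def
      by (rule has_derivative_eq_rhs)
        (simp add: fun_eq_iff linear_cmul[OF has_derivative_linear[OF that]] mult.commute)
  qed
  have "convex_on {0..1} (\<lambda>s. F (\<gamma> s))"
  proof (rule f''_ge0_imp_convex[where f' = "\<lambda>s. DF (\<gamma> s) h" and f'' = "\<lambda>s. D2F (\<gamma> s) h h"])
    fix s :: real
    assume s: "s \<in> {0..1}"
    show "((\<lambda>s. F (\<gamma> s)) has_real_derivative DF (\<gamma> s) h) (at s)"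
      by (rule comp[OF DF[OF \<gamma>[OF s]]])
    show "((\<lambda>s. DF (\<gamma> s) h) has_real_derivative D2F (\<gamma> s) h h) (at s)"
      by (rule comp[OF D2F[OF \<gamma>[OF s]]])
    show "0 \<le> D2F (\<gamma> s) h h"
      unfolding h_def by (rule nonneg[OF \<gamma>[OF s] xy])
  qed simp
  from convex_onD[OF this, of t 0 1] t show "F ((1 - t) *\<^sub>R x + t *\<^sub>R y) \<le> (1 - t) * F x + t * F y"
    by (simp add: \<gamma>_def h_def algebra_simps)
qed (rule assms)

section \<open>Blow-up of the barrier at the boundary\<close>

lemma filterlim_neg_ln_at_top:
  fixes d :: "'a \<Rightarrow> real"
  assumes "(d \<longlongrightarrow> 0) F" "\<forall>\<^sub>F x in F. 0 < d x"
  shows "filterlim (\<lambda>x. - ln (d x)) at_top F"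
proof -
  have "filterlim d (at_right 0) F"
    using assms by (auto simp: filterlim_at elim: eventually_mono)
  from filterlim_compose[OF ln_at_0 this] show ?thesis
    by (simp add: filterlim_uminus_at_bot)
qed

text \<open>At \<open>z = 0\<close> the arrow form is the form of \<open>X\<close>, so completing
  the square shows that \<open>X\<close> dominates the Schur complement; unit vectors then compare
  diagonal entries.\<close>

lemma trace_schur_l2_le:
  assumes "sym_pd X"
  shows "trace (schur_l2 X Y) \<le> trace X"
proof -
  have "x \<bullet> (schur_l2 X Y *v x) \<le> x \<bullet> (X *v x)" for x
  proof -
    have "0 \<le> v \<bullet> (X *v v)" for v
      using assms by (cases "v = 0") (auto simp: sym_pd_def less_imp_le)
    moreover have "arrow_form X Y x 0 = x \<bullet> (X *v x)"
      by (simp add: arrow_form_def)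
    ultimately show ?thesis
      using arrow_form_schur[of X Y x 0] sym_pd_imp_invertible[OF assms] assms
      by (simp add: sym_pd_def sum_nonneg del: inner_minus_left)
  qed
  from this[of "axis _ 1"] have "schur_l2 X Y $ i $ i \<le> X $ i $ i" for i
    by (simp add: matrix_vector_mult_basis inner_axis' column_def)
  then show ?thesis
    by (simp add: trace_def sum_mono)
qed

lemma F_hat_tendsto_at_top:
  fixes xs :: "nat \<Rightarrow> ('n::finite, 'k::finite) l2_space"
  assumes xs: "\<And>j. xs j \<in> l2_dom" and lim: "xs \<longlonglongrightarrow> b" and b: "b \<notin> l2_dom"
  shows "filterlim (\<lambda>j. F_hat (xs j)) at_top sequentially"
proof -
  obtain X Y where bXY: "b = (X, Y)"
    by (cases b)
  have pd: "sym_pd (fst (xs j))" "sym_pd (schur_p (xs j))" for j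
    using xs[of j] by (auto simp: l2_dom_def)
  have psd_lim: "transpose A = A \<and> (\<forall>x. 0 \<le> x \<bullet> (A *v x))"
    if "\<And>j. sym_pd (As j)" "As \<longlonglongrightarrow> A" for As and A :: "real^'n^'n"
  proof (intro conjI allI)
    have "(\<lambda>j. transpose (As j)) \<longlonglongrightarrow> transpose A"
      by (intro bounded_linear.tendsto[OF bounded_linear_transpose] that)
    then show "transpose A = A"
      using that LIMSEQ_unique by (auto simp: sym_pd_def)
    fix x :: "real^'n"
    have "bounded_linear (\<lambda>B::real^'n^'n. B *v x)"
      by (intro linear_conv_bounded_linear[THEN iffD1] linearI)
        (simp_all add: matrix_vector_mult_add_rdistrib scaleR_matrix_vector_assoc)
    then have "(\<lambda>j. x \<bullet> (As j *v x)) \<longlonglongrightarrow> x \<bullet> (A *v x)"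
      by (intro tendsto_inner tendsto_const bounded_linear.tendsto[of "\<lambda>B. B *v x"] that(2))
    moreover have "0 \<le> x \<bullet> (As j *v x)" for j
      using that(1)[of j] by (cases "x = 0") (auto simp: sym_pd_def less_imp_le)
    ultimately show "0 \<le> x \<bullet> (A *v x)"
      by (intro LIMSEQ_le_const) auto
  qed
  have Xlim: "(\<lambda>j. fst (xs j)) \<longlonglongrightarrow> X"
    using tendsto_fst[OF lim] by (simp add: bXY)
  have detX: "(\<lambda>j. det (fst (xs j))) \<longlonglongrightarrow> det X"
    by (rule continuous_on_tendsto_compose[OF continuous_on_det[of UNIV] Xlim]) auto
  show ?thesis
  proof (cases "det X = 0")
    \<comment> \<open>The Schur complement need not converge here, but its norm is bounded by the
      trace of the first block. Its log-determinant is therefore bounded above, while the other term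
      of the barrier blows up.\<close>
    case True
    have "(\<lambda>j. trace (fst (xs j))) \<longlonglongrightarrow> trace X"
      by (rule bounded_linear.tendsto[OF bounded_linear_trace Xlim])
    then have "Bseq (\<lambda>j. trace (fst (xs j)))"
      by (intro convergent_imp_Bseq convergentI)
    then obtain C where C: "\<And>j. trace (fst (xs j)) \<le> C"
      by (metis BseqE abs_le_D1 real_norm_def)
    then have S: "schur_p (xs j) \<in> cball 0 C" for j
      using norm_sym_pd_le_trace[OF pd(2)[of j]] trace_schur_l2_le[OF pd(1)[of j], of "snd (xs j)"] C[of j]
      unfolding mem_cball_0 by linarith
    have "bounded (det ` cball (0::real^'n^'n) C)"
      by (intro compact_imp_bounded compact_continuous_image continuous_on_det compact_cball)
    then obtain M where M: "\<And>A::real^'n^'n. A \<in> cball 0 C \<Longrightarrow> \<bar>det A\<bar> \<le> M"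
      unfolding bounded_iff by (metis imageI real_norm_def)
    have "ln (det (schur_p (xs j))) \<le> ln M" for j
      using sym_pd_det_pos[OF pd(2)[of j]] M[OF S[of j]] by (simp add: ln_mono)
    then have "- ln M + - ln (det (fst (xs j))) \<le> F_hat (xs j)" for j
      by (simp add: F_hat_def)
    moreover have "filterlim (\<lambda>j. - ln M + - ln (det (fst (xs j)))) at_top sequentially"
      using detX True sym_pd_det_pos[OF pd(1)]
      by (intro filterlim_tendsto_add_at_top[OF tendsto_const] filterlim_neg_ln_at_top) auto
    ultimately show ?thesis
      by (auto intro: filterlim_at_top_mono)
  next
    \<comment> \<open>Now the limit of the first block is positive definite and the Schur complement
      is continuous at \<open>b\<close>. Its limit is not positive definite, hence singular, while
      the other term of the barrier converges.\<close>
    case False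
    have X: "sym_pd X"
      using psd_lim[OF pd(1) Xlim] False psd_singular_or_sym_pd by blast
    have Slim: "(\<lambda>j. schur_p (xs j)) \<longlonglongrightarrow> schur_p b"
      using isCont_tendsto_compose[OF isCont_schur_l2 lim] sym_pd_imp_invertible[OF X] by (simp add: bXY)
    have "\<not> sym_pd (schur_p b)"
      using b X by (auto simp: l2_dom_def bXY)
    then have "det (schur_p b) = 0"
      using psd_lim[OF pd(2) Slim] psd_singular_or_sym_pd by blast
    moreover have "(\<lambda>j. det (schur_p (xs j))) \<longlonglongrightarrow> det (schur_p b)"
      by (rule continuous_on_tendsto_compose[OF continuous_on_det[of UNIV] Slim]) auto
    ultimately have "filterlim (\<lambda>j. - ln (det (schur_p (xs j)))) at_top sequentially"
      using sym_pd_det_pos[OF pd(2)] by (intro filterlim_neg_ln_at_top) auto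
    moreover have "(\<lambda>j. - ln (det (fst (xs j)))) \<longlonglongrightarrow> - ln (det X)"
      using sym_pd_det_pos[OF X] by (intro tendsto_minus tendsto_ln detX) auto
    ultimately have "filterlim (\<lambda>j. - ln (det (fst (xs j))) + - ln (det (schur_p (xs j)))) at_top sequentially"
      by (intro filterlim_tendsto_add_at_top)
    moreover have "F_hat (xs j) = - ln (det (fst (xs j))) + - ln (det (schur_p (xs j)))" for j
      by (simp add: F_hat_def)
    ultimately show ?thesis
      by simp
  qed
qed

section \<open>Assembly of the barrier properties\<close>

theorem mainTheorem4:
  shows "self_concordant_barrier (sym_space :: ((real^'n^'n) \<times> (real^'n^'n^'k::finite)) set)
           K_l2 l2_dom F_hat (2 * real CARD('n))"
proof -
  let ?E = "sym_space :: ((real^'n^'n) \<times> (real^'n^'n^'k)) set"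
  let ?D = "l2_dom :: ((real^'n^'n) \<times> (real^'n^'n^'k)) set"
  have K: "K_l2 = closure ?D"
    by (simp add: K_l2_def l2_dom_def)
  have pos: "0 < det (fst p)" "0 < det (schur_p p)" "invertible (fst p)" "invertible (schur_p p)"
    if "p \<in> ?D" for p
    using that sym_pd_det_pos sym_pd_imp_invertible by (auto simp: l2_dom_def)
  have ne: "?D \<noteq> {}"
    using mat_1_in_l2_dom by blast
  have convF: "convex_on ?D F_hat"
  proof (rule convex_on_second_derivative_nonneg[OF convex_l2_dom, where DF = DF_hat and D2F = D2F_hat])
    fix x y z assume "x \<in> ?D" "y \<in> ?D" "z \<in> ?D"
    then show "0 \<le> D2F_hat x (z - y) (z - y)"
      using l2_dom_subset_sym_space
      by (intro F_hat_self_concordant(1) subspace_diff[OF subspace_sym_space]) auto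
  qed (rule has_derivative_F_hat has_derivative_DF_hat, erule pos, erule pos)+
  have derivs: "\<exists>DF D2F D3F.
      (\<forall>x\<in>?D. (F_hat has_derivative DF x) (at x within ?E) \<and>
         (\<forall>h\<in>?E. ((\<lambda>y. DF y h) has_derivative D2F x h) (at x within ?E)) \<and>
         (\<forall>h\<in>?E. \<forall>k\<in>?E. ((\<lambda>y. D2F y h k) has_derivative D3F x h k) (at x within ?E))) \<and>
      (\<forall>h\<in>?E. \<forall>k\<in>?E. \<forall>l\<in>?E. continuous_on ?D (\<lambda>x. D3F x h k l)) \<and>
      (\<forall>x\<in>?D. \<forall>h\<in>?E.
         \<bar>D3F x h h h\<bar> \<le> 2 * (D2F x h h) powr (3/2) \<and>
         (DF x h)\<^sup>2 \<le> 2 * real CARD('n) * D2F x h h)"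
  proof (rule exI[of _ DF_hat], rule exI[of _ D2F_hat], rule exI[of _ D3F_hat], intro conjI ballI)
    fix x :: "(real^'n^'n) \<times> (real^'n^'n^'k)" and h k
    assume x: "x \<in> ?D"
    \<comment> \<open>The derivatives were computed in the full matrix space; here they are
      restricted to \<open>sym_space\<close>.\<close>
    show "(F_hat has_derivative DF_hat x) (at x within ?E)"
      by (rule has_derivative_at_withinI, rule has_derivative_F_hat) (rule pos[OF x])+
    show "((\<lambda>y. DF_hat y h) has_derivative D2F_hat x h) (at x within ?E)"
      by (rule has_derivative_at_withinI, rule has_derivative_DF_hat) (rule pos[OF x])+
    show "((\<lambda>y. D2F_hat y h k) has_derivative D3F_hat x h k) (at x within ?E)"
      by (rule has_derivative_at_withinI, rule has_derivative_D2F_hat) (rule pos[OF x])+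
    assume h: "h \<in> ?E"
    show "\<bar>D3F_hat x h h h\<bar> \<le> 2 * D2F_hat x h h powr (3/2)"
      by (rule F_hat_self_concordant(2)[OF x h])
    show "(DF_hat x h)\<^sup>2 \<le> 2 * real CARD('n) * D2F_hat x h h"
      by (rule F_hat_self_concordant(3)[OF x h])
  next
    fix h k l
    show "continuous_on ?D (\<lambda>x. D3F_hat x h k l)"
      by (intro continuous_at_imp_continuous_on ballI isCont_D3F_hat pos)
  qed
  show ?thesis
    unfolding self_concordant_barrier_def K
  proof (intro conjI)
    show "closure ?D \<subseteq> ?E"
      using l2_dom_subset_sym_space closed_subspace[OF subspace_sym_space] by (rule closure_minimal)
    show "?D = (top_of_set ?E) interior_of (closure ?D)"
      using interior_of_closure_convex_openin[OF subspace_imp_affine[OF subspace_sym_space] convex_l2_dom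
          openin_l2_dom ne] by simp
    show "\<forall>xs b. (\<forall>j. xs j \<in> ?D) \<longrightarrow> xs \<longlonglongrightarrow> b \<longrightarrow> b \<notin> ?D \<longrightarrow>
        filterlim (\<lambda>j. F_hat (xs j)) at_top sequentially"
      by (intro allI impI F_hat_tendsto_at_top) auto
  qed (rule derivs subspace_sym_space closed_closure convex_closure[OF convex_l2_dom] ne convF)+
qed

end
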